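(* For $n\geq 1$ define \[ d_n=\prod_{p\ \text{prime},\ p<n} p^{\max\{t:\ p^t\leq s_p(n)\}}, \] where $s_p(n)=\alpha_0+\alpha_1+\dots+\alpha_r$ is the sum of the digits in the base-$p$ expansion $n=\alpha_0+\alpha_1p+\dots+\alpha_rp^r$. Let $H=\log(\mathrm{e}^{A}\mathrm{e}^{B})\in\mathbb{Q}\langle\langle A,B\rangle\rangle$ be the Baker--Campbell--Hausdorff series. Then for every $n\geq 1$ and every word $w\in\{A,B\}^n$ of length $n$, \[ \mathrm{denom}(\mathrm{coeff}(w,H))\ \big|\ n!\,d_n . \]
   Context: $\mathbb{Q}\langle\langle A,B\rangle\rangle$ is the ring of formal power series in non-commuting variables $A,B$ with rational coefficients, and $H=\log(\mathrm{e}^{A}\mathrm{e}^{B})=\sum_{k\geq1}\frac{(-1)^{k+1}}{k}(\mathrm{e}^{A}\mathrm{e}^{B}-1)^k$, where $\mathrm{e}^{X}=\sum_{m\ge0}X^m/m!$. $\{A,B\}^n$ is the set of words of length $n$ over the alphabet $\{A,B\}$; for a series $X$ and a word $w$, $\mathrm{coeff}(w,X)\in\mathbb{Q}$ is the coefficient of $w$ in $X$. For $r\in\mathbb{Q}$, $\mathrm{denom}(r)$ is the smallest positive integer $d$ with $rd\in\mathbb{Z}$ (so $\mathrm{denom}(0)=1$). *)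

theory Defs
  imports Complex_Main "HOL-Computational_Algebra.Primes"
begin

subsection \<open>Formal power series over \<open>\<rat>\<close> in non-commuting variables\<close>

text \<open>A series over the alphabet \<open>'a\<close> is the family of its coefficients, indexed by words.\<close>

typedef 'a ncps = "UNIV :: ('a list \<Rightarrow> rat) set"
  morphisms coeff_fun Abs_ncps ..

setup_lifting type_definition_ncps

definition ncps_coeff :: "'a list \<Rightarrow> 'a ncps \<Rightarrow> rat" where
  "ncps_coeff w X = coeff_fun X w"

lemma ncps_eqI: "(\<And>w. ncps_coeff w X = ncps_coeff w Y) \<Longrightarrow> X = Y"
  unfolding ncps_coeff_def by transfer auto

instantiation ncps :: (type) ring_1
begin

lift_definition zero_ncps :: "'a ncps" is "\<lambda>w. 0" .

lift_definition one_ncps :: "'a ncps" is "\<lambda>w. if w = [] then 1 else 0" .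

lift_definition plus_ncps :: "'a ncps \<Rightarrow> 'a ncps \<Rightarrow> 'a ncps" is
  "\<lambda>f g w. f w + g w" .

lift_definition minus_ncps :: "'a ncps \<Rightarrow> 'a ncps \<Rightarrow> 'a ncps" is
  "\<lambda>f g w. f w - g w" .

lift_definition uminus_ncps :: "'a ncps \<Rightarrow> 'a ncps" is
  "\<lambda>f w. - f w" .

lift_definition times_ncps :: "'a ncps \<Rightarrow> 'a ncps \<Rightarrow> 'a ncps" is
  "\<lambda>f g w. \<Sum>i\<le>length w. f (take i w) * g (drop i w)" .

instance
proof
  fix a b c :: "'a ncps"
  show "a + b + c = a + (b + c)" by transfer (simp add: add.assoc)
  show "a + b = b + a" by transfer (simp add: add.commute)
  show "0 + a = a" by transfer simp
  show "- a + a = 0" by transfer simp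
  show "a - b = a + - b" by transfer simp
  show "(a + b) * c = a * c + b * c"
    by transfer (simp add: distrib_right sum.distrib)
  show "a * (b + c) = a * b + a * c"
    by transfer (simp add: distrib_left sum.distrib)
  show "(0::'a ncps) \<noteq> 1"
    by transfer (metis zero_neq_one)
  show "1 * a = a"
  proof (transfer, rule ext)
    fix a :: "'a list \<Rightarrow> rat" and w :: "'a list"
    have "(\<Sum>i\<le>length w. (if take i w = [] then 1 else 0) * a (drop i w)) =
          (\<Sum>i\<le>length w. if i = 0 then a w else 0)"
      by (rule sum.cong) auto
    then show "(\<Sum>i\<le>length w. (if take i w = [] then 1 else 0) * a (drop i w)) = a w"
      by simp
  qed
  show "a * 1 = a"
  proof (transfer, rule ext)
    fix a :: "'a list \<Rightarrow> rat" and w :: "'a list"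
    have "(\<Sum>i\<le>length w. a (take i w) * (if drop i w = [] then 1 else 0)) =
          (\<Sum>i\<le>length w. if i = length w then a w else 0)"
      by (rule sum.cong) auto
    then show "(\<Sum>i\<le>length w. a (take i w) * (if drop i w = [] then 1 else 0)) = a w"
      by simp
  qed
  show "a * b * c = a * (b * c)"
  proof (transfer, rule ext)
    fix a b c :: "'a list \<Rightarrow> rat" and w :: "'a list"
    have "(\<Sum>i\<le>length w. (\<Sum>j\<le>length (take i w).
             a (take j (take i w)) * b (drop j (take i w))) * c (drop i w)) =
          (\<Sum>i\<le>length w. \<Sum>j\<le>i. a (take j w) * b (take (i - j) (drop j w)) * c (drop i w))"
      unfolding sum_distrib_right
      by (intro sum.cong) (auto simp: min_def drop_take)
    also have "\<dots> = (\<Sum>j\<le>length w. \<Sum>i\<le>length w - j.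
        a (take j w) * b (take i (drop j w)) * c (drop (i + j) w))"
      unfolding sum.Sigma[OF finite_atMost ballI[OF finite_atMost]]
      by (rule sum.reindex_bij_witness
            [where i = "\<lambda>(j, i). (i + j, j)" and j = "\<lambda>(i, j). (j, i - j)"]) auto
    also have "\<dots> = (\<Sum>i\<le>length w. a (take i w) * (\<Sum>j\<le>length (drop i w).
        b (take j (drop i w)) * c (drop j (drop i w))))"
      unfolding sum_distrib_left
      by (intro sum.cong) (auto simp: mult.assoc)
    finally show "(\<Sum>i\<le>length w. (\<Sum>j\<le>length (take i w).
             a (take j (take i w)) * b (drop j (take i w))) * c (drop i w)) =
        (\<Sum>i\<le>length w. a (take i w) * (\<Sum>j\<le>length (drop i w).
        b (take j (drop i w)) * c (drop j (drop i w))))" .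
  qed
qed

end

lift_definition ncps_var :: "'a \<Rightarrow> 'a ncps" is "\<lambda>x w. if w = [x] then 1 else 0" .

lift_definition ncps_scale :: "rat \<Rightarrow> 'a ncps \<Rightarrow> 'a ncps" is "\<lambda>c f w. c * f w" .

text \<open>
  The infinite sum of a family of series, taken coefficientwise.  It is meaningful if every word
  has a nonzero coefficient in only finitely many members of the family; a coefficient for which
  this fails is set to 0 by the convention for \<^const>\<open>sum\<close>.  Lemmas \<open>ncps_coeff_exp\<close> and
  \<open>ncps_coeff_log\<close> below show that this never happens for the exponential and logarithm used here.
\<close>

lift_definition formal_sum :: "(nat \<Rightarrow> 'a ncps) \<Rightarrow> nat set \<Rightarrow> 'a ncps" is
  "\<lambda>f K w. \<Sum>k\<in>{k\<in>K. f k w \<noteq> 0}. f k w" .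

definition ncps_exp :: "'a ncps \<Rightarrow> 'a ncps" where
  "ncps_exp X = formal_sum (\<lambda>m. ncps_scale (1 / fact m) (X ^ m)) {0..}"

definition ncps_log :: "'a ncps \<Rightarrow> 'a ncps" where
  "ncps_log Y = formal_sum (\<lambda>k. ncps_scale ((-1) ^ (k + 1) / of_nat k) ((Y - 1) ^ k)) {1..}"

datatype letter = Letter_A | Letter_B

definition BCH :: "letter ncps" where
  "BCH = ncps_log (ncps_exp (ncps_var Letter_A) * ncps_exp (ncps_var Letter_B))"

lemma ncps_coeff_zero [simp]: "ncps_coeff w 0 = 0"
  and ncps_coeff_one: "ncps_coeff w 1 = (if w = [] then 1 else 0)"
  and ncps_coeff_add [simp]: "ncps_coeff w (X + Y) = ncps_coeff w X + ncps_coeff w Y"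
  and ncps_coeff_diff [simp]: "ncps_coeff w (X - Y) = ncps_coeff w X - ncps_coeff w Y"
  and ncps_coeff_uminus [simp]: "ncps_coeff w (- X) = - ncps_coeff w X"
  and ncps_coeff_mult: "ncps_coeff w (X * Y) = (\<Sum>i\<le>length w. ncps_coeff (take i w) X * ncps_coeff (drop i w) Y)"
  and ncps_coeff_scale [simp]: "ncps_coeff w (ncps_scale c X) = c * ncps_coeff w X"
  unfolding ncps_coeff_def by (transfer, simp)+

lemma ncps_coeff_var: "ncps_coeff w (ncps_var x) = (if w = [x] then 1 else 0)"
  unfolding ncps_coeff_def by transfer simp

lemma ncps_coeff_formal_sum:
  "ncps_coeff w (formal_sum f K) = (\<Sum>k\<in>{k\<in>K. ncps_coeff w (f k) \<noteq> 0}. ncps_coeff w (f k))"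
  unfolding ncps_coeff_def by transfer simp

lemma ncps_coeff_power_eq_0:
  assumes "ncps_coeff [] X = 0" "length w < m"
  shows "ncps_coeff w (X ^ m) = 0"
  using assms(2)
proof (induction m arbitrary: w)
  case (Suc m)
  have "ncps_coeff (take i w) X * ncps_coeff (drop i w) (X ^ m) = 0" if "i \<le> length w" for i
    using Suc that assms(1) by (cases "i = 0") auto
  then show ?case by (simp add: ncps_coeff_mult del: mult_eq_0_iff)
qed simp

lemma ncps_coeff_exp:
  assumes "ncps_coeff [] X = 0"
  shows "ncps_coeff w (ncps_exp X) = (\<Sum>m\<le>length w. ncps_coeff w (X ^ m) / fact m)"
  unfolding ncps_exp_def ncps_coeff_formal_sum
proof (rule sum.mono_neutral_cong_left)
  show "{k \<in> {0..}. ncps_coeff w (ncps_scale (1 / fact k) (X ^ k)) \<noteq> 0} \<subseteq> {..length w}"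
    using ncps_coeff_power_eq_0[OF assms, of w] by (auto simp: not_less[symmetric])
qed auto

lemma ncps_coeff_log:
  assumes "ncps_coeff [] Y = 1"
  shows "ncps_coeff w (ncps_log Y) =
    (\<Sum>k = 1..length w. (-1) ^ (k + 1) / of_nat k * ncps_coeff w ((Y - 1) ^ k))"
  unfolding ncps_log_def ncps_coeff_formal_sum
proof (rule sum.mono_neutral_cong_left)
  have "ncps_coeff [] (Y - 1) = 0" using assms by (simp add: ncps_coeff_one)
  from ncps_coeff_power_eq_0[OF this, of w]
  show "{k \<in> {1..}. ncps_coeff w (ncps_scale ((-1) ^ (k + 1) / of_nat k) ((Y - 1) ^ k)) \<noteq> 0}
      \<subseteq> {1..length w}"
    by (auto simp: not_less[symmetric])
qed auto

lemma ncps_coeff_Nil_exp: "ncps_coeff [] X = 0 \<Longrightarrow> ncps_coeff [] (ncps_exp X) = 1"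
  by (simp add: ncps_coeff_exp ncps_coeff_one)

lemma ncps_coeff_Nil_exp_mult_exp:
  "ncps_coeff [] (ncps_exp (ncps_var Letter_A) * ncps_exp (ncps_var Letter_B)) = 1"
  by (simp add: ncps_coeff_mult ncps_coeff_Nil_exp ncps_coeff_var)


subsection \<open>Denominators and the numbers \<open>d\<^sub>n\<close>\<close>

definition denom :: "rat \<Rightarrow> nat" where
  "denom r = (LEAST d. d > 0 \<and> r * of_nat d \<in> \<int>)"

text \<open>
  The \<open>i\<close>-th base-\<open>p\<close> digit of \<open>n\<close> is \<open>n div p ^ i mod p\<close>, which vanishes for
  \<open>i > n\<close> if \<open>p \<ge> 2\<close>.
\<close>

definition digit_sum :: "nat \<Rightarrow> nat \<Rightarrow> nat" where
  "digit_sum p n = (\<Sum>i\<le>n. n div p ^ i mod p)"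

definition bch_d :: "nat \<Rightarrow> nat" where
  "bch_d n = (\<Prod>p | prime p \<and> p < n. p ^ Max {t. p ^ t \<le> digit_sum p n})"

lemma digit_sum_expansion:
  fixes a :: "nat \<Rightarrow> nat"
  assumes p: "p \<ge> 2" and a: "\<And>i. i \<le> r \<Longrightarrow> a i < p"
    and n: "n = (\<Sum>i\<le>r. a i * p ^ i)"
  shows "digit_sum p n = (\<Sum>i\<le>r. a i)"
proof -
  define b where "b i = (if i \<le> r then a i else 0)" for i
  have b: "b i < p" for i using a p by (auto simp: b_def)
  have low: "(\<Sum>i<k. b i * p ^ i) < p ^ k" for k
  proof (induction k)
    case (Suc k)
    have "(\<Sum>i<Suc k. b i * p ^ i) < p ^ k + b k * p ^ k" using Suc by simp
    also have "\<dots> = (b k + 1) * p ^ k" by simp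
    also have "\<dots> \<le> p * p ^ k" using b[of k] by (intro mult_right_mono) auto
    finally show ?case by simp
  qed simp
  have ext: "n = (\<Sum>i<m. b i * p ^ i)" if "m > r" for m
  proof -
    have "(\<Sum>i<m. b i * p ^ i) = (\<Sum>i\<le>r. a i * p ^ i)"
      using that by (intro sum.mono_neutral_cong_right) (auto simp: b_def)
    then show ?thesis using n by simp
  qed
  have digit: "n div p ^ i mod p = b i" for i
  proof -
    define m where "m = Suc (max r i)"
    have split: "{..<m} = {..<i} \<union> {i} \<union> {Suc i..<m}" by (auto simp: m_def)
    have "n = (\<Sum>j<m. b j * p ^ j)" by (rule ext) (simp add: m_def)
    also have "\<dots> = (\<Sum>j<i. b j * p ^ j) + b i * p ^ i + (\<Sum>j\<in>{Suc i..<m}. b j * p ^ j)"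
      unfolding split by (subst sum.union_disjoint; auto)+
    also have "(\<Sum>j\<in>{Suc i..<m}. b j * p ^ j) =
        p ^ i * (p * (\<Sum>j\<in>{Suc i..<m}. b j * p ^ (j - Suc i)))"
      unfolding sum_distrib_left
    proof (rule sum.cong[OF refl])
      fix j assume "j \<in> {Suc i..<m}"
      then have "p ^ j = p ^ i * (p * p ^ (j - Suc i))"
        by (metis atLeastLessThan_iff le_add_diff_inverse power_Suc power_add add_Suc_shift)
      then show "b j * p ^ j = p ^ i * (p * (b j * p ^ (j - Suc i)))" by simp
    qed
    finally have "n = (\<Sum>j<i. b j * p ^ j) +
        p ^ i * (b i + p * (\<Sum>j\<in>{Suc i..<m}. b j * p ^ (j - Suc i)))"
      by (simp add: algebra_simps)
    then have "n div p ^ i = b i + p * (\<Sum>j\<in>{Suc i..<m}. b j * p ^ (j - Suc i))"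
      using low[of i] p by simp
    then show ?thesis using b[of i] by simp
  qed
  have "b i = 0" if "i > n" for i
  proof -
    have "n < p ^ i" using that p
      by (metis less_exp less_trans power_mono order_less_le_trans zero_le)
    then show ?thesis using digit[of i] by simp
  qed
  then have "(\<Sum>i\<le>n. b i) = (\<Sum>i\<le>max n r. b i)"
    by (intro sum.mono_neutral_left) auto
  also have "\<dots> = (\<Sum>i\<le>r. a i)"
    by (intro sum.mono_neutral_cong_right) (auto simp: b_def)
  finally show ?thesis by (simp add: digit_sum_def digit)
qed

end

theory Submission
  imports Defs
begin

text \<open>
  Expanding the logarithm, the coefficient of a word of length \<open>n\<close> becomes an integer combination of
  terms \<open>1 / (k \<cdot> m\<^sub>1! \<cdots> m\<^sub>r!)\<close> with \<open>m\<^sub>1 + \<dots> + m\<^sub>r = n\<close>, all \<open>m\<^sub>i \<ge> 1\<close> and \<open>r \<ge> k\<close>.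
  It therefore suffices that \<open>k\<close> divides \<open>d\<^sub>n\<close> times the multinomial coefficient
  \<open>M = n! / (m\<^sub>1! \<cdots> m\<^sub>r!)\<close>.  By Kummer's theorem
  \<open>(p - 1) v\<^sub>p(M) = s\<^sub>p(m\<^sub>1) + \<dots> + s\<^sub>p(m\<^sub>r) - s\<^sub>p(n) \<ge> k - s\<^sub>p(n)\<close>, so a power of \<open>p\<close> that divides
  \<open>k\<close> and exceeds \<open>s\<^sub>p(n)\<close> forces enough factors \<open>p\<close> into \<open>M\<close>, while the powers up to \<open>s\<^sub>p(n)\<close> are
  supplied by \<open>d\<^sub>n\<close>.
\<close>

subsection \<open>Digit sums\<close>

lemma digit_sum_eq_sum_atMost:
  assumes "p \<ge> 2" "n \<le> N"
  shows "digit_sum p n = (\<Sum>i\<le>N. n div p ^ i mod p)"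
  unfolding digit_sum_def
proof (rule sum.mono_neutral_left)
  have "n div p ^ i mod p = 0" if "n < i" for i
    using that power_gt_expt[of p i] assms(1) by simp
  then show "\<forall>i\<in>{..N} - {..n}. n div p ^ i mod p = 0" by auto
qed (use assms(2) in auto)

lemma digit_sum_0 [simp]: "digit_sum p 0 = 0"
  by (simp add: digit_sum_def)

lemma digit_sum_mult_add:
  assumes "r < p" "p \<ge> 2"
  shows "digit_sum p (p * q + r) = r + digit_sum p q"
proof -
  define n where "n = p * q + r"
  have "n mod p = r" and "n div p = q" using assms(1) by (simp_all add: n_def)
  then have "n div p ^ Suc i = q div p ^ i" for i by (simp add: div_mult2_eq)
  have "q \<le> n" using assms(2) by (simp add: n_def trans_le_add1)
  have "digit_sum p n = (\<Sum>i\<le>Suc n. n div p ^ i mod p)"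
    using assms(2) by (intro digit_sum_eq_sum_atMost) simp_all
  also have "\<dots> = r + (\<Sum>i\<le>n. q div p ^ i mod p)"
    unfolding sum.atMost_Suc_shift \<open>\<And>i. n div p ^ Suc i = q div p ^ i\<close>
    using \<open>n mod p = r\<close> by simp
  also have "(\<Sum>i\<le>n. q div p ^ i mod p) = digit_sum p q"
    using digit_sum_eq_sum_atMost[OF assms(2) \<open>q \<le> n\<close>] by simp
  finally show ?thesis by (simp add: n_def)
qed

lemma digit_sum_pos:
  assumes "p \<ge> 2" "n > 0"
  shows "digit_sum p n > 0"
  using assms(2)
proof (induction n rule: less_induct)
  case (less n)
  have "digit_sum p n = n mod p + digit_sum p (n div p)"
    using digit_sum_mult_add[of "n mod p" p "n div p"] assms(1) by simp
  moreover have "n mod p > 0 \<or> n div p > 0"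
    using less.prems by (metis div_mult_mod_eq add_0_right gr0I mult_0)
  moreover have "n div p < n" using less.prems assms(1) by simp
  ultimately show ?case using less.IH[of "n div p"] by auto
qed

lemma digit_sum_eq_self: "n < p \<Longrightarrow> p \<ge> 2 \<Longrightarrow> digit_sum p n = n"
  using digit_sum_mult_add[of n p 0] by simp

lemma digit_sum_base_eq_1: "p \<ge> 2 \<Longrightarrow> digit_sum p p = 1"
  using digit_sum_mult_add[of 0 p 1] by (simp add: digit_sum_eq_self)

lemma digit_sum_Suc:
  assumes "p \<ge> 2"
  shows "digit_sum p (Suc n) + (p - 1) * multiplicity p (Suc n) = Suc (digit_sum p n)"
proof (induction n rule: less_induct)
  case (less n)
  define q r where "q = n div p" and "r = n mod p"
  have n_eq: "n = p * q + r" and "r < p" using assms by (simp_all add: q_def r_def)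
  then have digit_sum_n_eq: "digit_sum p n = r + digit_sum p q"
    using digit_sum_mult_add assms by blast
  show ?case
  proof (cases "Suc r < p")
    case True
    have "Suc n = p * q + Suc r" using n_eq by simp
    moreover have "\<not> p dvd p * q + Suc r"
      using True dvd_add_right_iff[of p "p * q" "Suc r"] nat_dvd_not_less[of "Suc r" p] by simp
    ultimately show ?thesis
      using digit_sum_mult_add[OF True assms, of q] digit_sum_n_eq
      by (simp add: not_dvd_imp_multiplicity_0)
  next
    case False
    then have "r = p - 1" using \<open>r < p\<close> by simp
    then have Suc_n_eq: "Suc n = p * Suc q" using n_eq assms by simp
    have "1 * q \<le> p * q" using assms by (intro mult_right_mono) auto
    then have "q < n" using n_eq \<open>r = p - 1\<close> assms by linarith
    have "digit_sum p (Suc n) = digit_sum p (Suc q)"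
      using digit_sum_mult_add[of 0 p "Suc q"] Suc_n_eq assms by simp
    moreover have "multiplicity p (Suc n) = Suc (multiplicity p (Suc q))"
      unfolding Suc_n_eq using assms by (intro multiplicity_times_same) auto
    ultimately show ?thesis
      using less.IH[OF \<open>q < n\<close>] digit_sum_n_eq \<open>r = p - 1\<close> by simp
  qed
qed

subsection \<open>Prime powers in multinomial coefficients\<close>

theorem Legendre_multiplicity_fact:
  assumes "prime p"
  shows "(p - 1) * multiplicity p (fact n :: nat) + digit_sum p n = n"
proof (induction n)
  case (Suc n)
  have "multiplicity p (fact (Suc n) :: nat) = multiplicity p (Suc n) + multiplicity p (fact n :: nat)"
    unfolding fact_Suc of_nat_id
    using assms by (intro prime_elem_multiplicity_mult_distrib) auto
  then show ?case
    using Suc digit_sum_Suc[OF prime_ge_2_nat[OF assms], of n] by (simp add: algebra_simps)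
qed simp

theorem Kummer_multiplicity_binomial:
  assumes "prime p"
  shows "(p - 1) * multiplicity p (m + n choose m) + digit_sum p (m + n) =
    digit_sum p m + digit_sum p n"
proof -
  have "multiplicity p (fact (m + n) :: nat) = multiplicity p (fact m * fact n * (m + n choose m))"
    using binomial_fact_lemma[of m "m + n"] by simp
  also have "\<dots> = multiplicity p (fact m :: nat) + multiplicity p (fact n :: nat)
      + multiplicity p (m + n choose m)"
    using assms by (simp add: prime_elem_multiplicity_mult_distrib)
  finally show ?thesis
    using Legendre_multiplicity_fact[OF assms, of "m + n"] Legendre_multiplicity_fact[OF assms, of m]
      Legendre_multiplicity_fact[OF assms, of n]
    by (simp add: add_mult_distrib2)
qed

fun multinomial :: "nat list \<Rightarrow> nat" where
  "multinomial [] = 1"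
| "multinomial (m # ms) = (m + sum_list ms choose m) * multinomial ms"

lemma multinomial_pos: "multinomial ms > 0"
  by (induction ms) auto

theorem Kummer_multiplicity_multinomial:
  assumes "prime p"
  shows "(p - 1) * multiplicity p (multinomial ms) + digit_sum p (sum_list ms) =
    (\<Sum>m\<leftarrow>ms. digit_sum p m)"
proof (induction ms)
  case (Cons m ms)
  have "multiplicity p (multinomial (m # ms)) =
      multiplicity p (m + sum_list ms choose m) + multiplicity p (multinomial ms)"
    using assms multinomial_pos[of ms] by (simp add: prime_elem_multiplicity_mult_distrib)
  then show ?case
    using Cons.IH Kummer_multiplicity_binomial[OF assms, of m "sum_list ms"]
    by (simp add: add_mult_distrib2)
qed simp

lemma length_le_sum_list_digit_sum:
  assumes "p \<ge> 2" "0 \<notin> set ms"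
  shows "length ms \<le> (\<Sum>m\<leftarrow>ms. digit_sum p m)"
  using assms(2)
proof (induction ms)
  case (Cons m ms)
  moreover have "digit_sum p m > 0" using Cons.prems assms(1) by (intro digit_sum_pos) auto
  ultimately show ?case by simp
qed simp

lemma power_add_mult_le_power_add:
  fixes p :: nat
  assumes "p \<ge> 1"
  shows "p ^ t + (p - 1) * j \<le> p ^ (t + j)"
proof (induction j)
  case (Suc j)
  have "p ^ t + (p - 1) * Suc j = p ^ t + (p - 1) * j + (p - 1)" by simp
  also have "\<dots> \<le> p ^ (t + j) + (p - 1) * p ^ (t + j)" using Suc assms by (intro add_mono) auto
  also have "\<dots> = p ^ (t + Suc j)" using assms by (simp add: algebra_simps)
  finally show ?case .
qed simp

lemma multiplicity_le_multiplicity_multinomial: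
  assumes "prime p" "0 \<notin> set ms" "0 < k" "k \<le> length ms"
    and digit_sum_less: "digit_sum p (sum_list ms) < p ^ Suc t"
  shows "multiplicity p k \<le> multiplicity p (multinomial ms) + t"
proof (rule ccontr)
  define M where "M = multiplicity p (multinomial ms)"
  have "p \<ge> 2" using \<open>prime p\<close> by (rule prime_ge_2_nat)
  assume "\<not> multiplicity p k \<le> multiplicity p (multinomial ms) + t"
  then have "p ^ (Suc t + M) \<le> p ^ multiplicity p k"
    using \<open>p \<ge> 2\<close> by (intro power_increasing) (auto simp: M_def)
  also have "\<dots> \<le> k" using \<open>0 < k\<close> by (intro dvd_imp_le multiplicity_dvd)
  also have "\<dots> \<le> (\<Sum>m\<leftarrow>ms. digit_sum p m)"
    using length_le_sum_list_digit_sum[OF \<open>p \<ge> 2\<close> \<open>0 \<notin> set ms\<close>] \<open>k \<le> length ms\<close> by simp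
  also have "\<dots> = (p - 1) * M + digit_sum p (sum_list ms)"
    unfolding M_def using Kummer_multiplicity_multinomial[OF \<open>prime p\<close>] by simp
  also have "\<dots> < p ^ Suc t + (p - 1) * M" using digit_sum_less by simp
  also have "\<dots> \<le> p ^ (Suc t + M)" using \<open>p \<ge> 2\<close> by (intro power_add_mult_le_power_add) simp
  finally show False by simp
qed

subsection \<open>The numbers \<open>d\<^sub>n\<close>\<close>

text \<open>For \<open>m = 0\<close> the maximum is over the empty set, and the bound holds whatever its value.\<close>

lemma less_power_Suc_Max_power_le:
  fixes p m :: nat
  assumes "p \<ge> 2"
  shows "m < p ^ Suc (Max {t. p ^ t \<le> m})"
proof -
  have "{t. p ^ t \<le> m} \<subseteq> {..m}"
    using power_gt_expt[of p] assms by (auto intro: less_imp_le order.strict_trans2)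
  then have "finite {t. p ^ t \<le> m}" by (rule finite_subset) simp
  then have "Suc (Max {t. p ^ t \<le> m}) \<notin> {t. p ^ t \<le> m}"
    using Max_ge by (metis Suc_n_not_le_n)
  then show ?thesis by simp
qed

lemma bch_d_pos: "bch_d n > 0"
  unfolding bch_d_def by (intro prod_pos) (auto dest: prime_gt_0_nat)

lemma multiplicity_bch_d:
  assumes "prime p" "p < n"
  shows "multiplicity p (bch_d n) = Max {t. p ^ t \<le> digit_sum p n}"
  unfolding bch_d_def using assms by (subst multiplicity_prod_prime_powers) auto

lemma digit_sum_less_power_multiplicity_bch_d:
  assumes "prime p"
  shows "digit_sum p n < p ^ Suc (multiplicity p (bch_d n))"
proof -
  have "p \<ge> 2" using assms by (rule prime_ge_2_nat)
  show ?thesis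
  proof (cases "p < n")
    case True
    then show ?thesis
      using less_power_Suc_Max_power_le[OF \<open>p \<ge> 2\<close>] by (simp add: multiplicity_bch_d assms)
  next
    case False
    then have "digit_sum p n < p"
      using digit_sum_eq_self[of n p] digit_sum_base_eq_1[of p] \<open>p \<ge> 2\<close> by (cases "n = p") auto
    also have "p \<le> p ^ Suc (multiplicity p (bch_d n))" using \<open>p \<ge> 2\<close> by simp
    finally show ?thesis .
  qed
qed

theorem dvd_multinomial_mult_bch_d:
  assumes "0 \<notin> set ms" "0 < k" "k \<le> length ms"
  shows "k dvd multinomial ms * bch_d (sum_list ms)"
proof (rule multiplicity_le_imp_dvd)
  show "k \<noteq> 0" using assms(2) by simp
next
  fix p :: nat
  assume "prime p"
  then have "multiplicity p (multinomial ms * bch_d (sum_list ms)) =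
      multiplicity p (multinomial ms) + multiplicity p (bch_d (sum_list ms))"
    using multinomial_pos[of ms] bch_d_pos[of "sum_list ms"]
    by (simp add: prime_elem_multiplicity_mult_distrib)
  then show "multiplicity p k \<le> multiplicity p (multinomial ms * bch_d (sum_list ms))"
    using multiplicity_le_multiplicity_multinomial[OF \<open>prime p\<close> assms]
      digit_sum_less_power_multiplicity_bch_d[OF \<open>prime p\<close>] by simp
qed

subsection \<open>Integer combinations of products of inverse factorials\<close>

interpretation int_module: module "\<lambda>(c::int) (x::'a::ring_1). of_int c * x"
  by unfold_locales (simp_all add: algebra_simps)

lemma int_span_mult:
  fixes x y :: "'a::ring_1"
  assumes "x \<in> int_module.span S" "y \<in> int_module.span T"
    and generators: "\<And>s t. s \<in> S \<Longrightarrow> t \<in> T \<Longrightarrow> s * t \<in> int_module.span U"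
  shows "x * y \<in> int_module.span U"
  using assms(1)
proof (induction rule: int_module.span_induct)
  case base
  show ?case
    by (auto simp: int_module.subspace_def distrib_right mult.assoc
        intro: int_module.span_zero int_module.span_add int_module.span_scale)
next
  case (step s)
  have mult_of_int: "s * (of_int c * z) = of_int c * (s * z)" for c :: int and z
    by (metis mult.assoc mult_of_int_commute)
  show ?case
    using assms(2)
  proof (induction rule: int_module.span_induct)
    case base
    show ?case
      by (auto simp: int_module.subspace_def distrib_left mult_of_int
          intro: int_module.span_zero int_module.span_add int_module.span_scale)
  qed (use step generators in blast)
qed

definition compositions :: "nat \<Rightarrow> nat \<Rightarrow> nat list set" where
  "compositions k n = {ms. 0 \<notin> set ms \<and> k \<le> length ms \<and> sum_list ms = n}"

definition inverse_fact_prod :: "nat list \<Rightarrow> rat" where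
  "inverse_fact_prod ms = (\<Prod>m\<leftarrow>ms. 1 / fact m)"

lemma inverse_fact_prod_append:
  "inverse_fact_prod (ms @ ns) = inverse_fact_prod ms * inverse_fact_prod ns"
  by (simp add: inverse_fact_prod_def)

lemma inverse_fact_prod_mult_fact:
  "inverse_fact_prod ms * fact (sum_list ms) = of_nat (multinomial ms)"
proof (induction ms)
  case (Cons m ms)
  have "inverse_fact_prod (m # ms) * fact (sum_list (m # ms)) =
      fact (m + sum_list ms) / (fact m * fact (sum_list ms)) *
      (inverse_fact_prod ms * fact (sum_list ms))"
    by (simp add: inverse_fact_prod_def)
  also have "\<dots> = of_nat (multinomial (m # ms))"
    unfolding Cons.IH by (simp add: binomial_fact)
  finally show ?case .
qed (simp add: inverse_fact_prod_def)

definition inverse_fact_span :: "nat \<Rightarrow> nat \<Rightarrow> rat set" where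
  "inverse_fact_span k n = int_module.span (inverse_fact_prod ` compositions k n)"

lemma zero_in_inverse_fact_span [simp]: "0 \<in> inverse_fact_span k n"
  by (simp add: inverse_fact_span_def int_module.span_zero)

lemma sum_in_inverse_fact_span:
  "(\<And>i. i \<in> I \<Longrightarrow> f i \<in> inverse_fact_span k n) \<Longrightarrow> sum f I \<in> inverse_fact_span k n"
  unfolding inverse_fact_span_def by (rule int_module.span_sum)

lemma inverse_fact_prod_in_inverse_fact_span:
  "ms \<in> compositions k n \<Longrightarrow> inverse_fact_prod ms \<in> inverse_fact_span k n"
  unfolding inverse_fact_span_def by (intro int_module.span_base imageI)

lemma mult_in_inverse_fact_span:
  assumes "x \<in> inverse_fact_span k m" "y \<in> inverse_fact_span l n"
  shows "x * y \<in> inverse_fact_span (k + l) (m + n)"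
  using assms unfolding inverse_fact_span_def
proof (rule int_span_mult, elim imageE)
  fix s t :: rat and ms ns
  assume "ms \<in> compositions k m" "ns \<in> compositions l n"
  then have "ms @ ns \<in> compositions (k + l) (m + n)" by (auto simp: compositions_def)
  then have "inverse_fact_prod (ms @ ns) \<in>
      int_module.span (inverse_fact_prod ` compositions (k + l) (m + n))"
    by (intro int_module.span_base imageI)
  moreover assume "s = inverse_fact_prod ms" "t = inverse_fact_prod ns"
  ultimately show "s * t \<in> int_module.span (inverse_fact_prod ` compositions (k + l) (m + n))"
    by (simp add: inverse_fact_prod_append)
qed

lemma inverse_fact_span_0_eq:
  assumes "n > 0"
  shows "inverse_fact_span 0 n = inverse_fact_span 1 n"
proof -
  have "compositions 0 n = compositions 1 n"
    using assms by (auto simp: compositions_def Suc_le_eq)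
  then show ?thesis by (simp add: inverse_fact_span_def)
qed

lemma inverse_fact_span_divide_in_Ints:
  assumes "x \<in> inverse_fact_span k n" "k > 0"
  shows "x / of_nat k * of_nat (fact n * bch_d n) \<in> \<int>"
  using assms(1) unfolding inverse_fact_span_def
proof (induction rule: int_module.span_induct)
  case base
  show ?case
    by (auto simp: int_module.subspace_def add_divide_distrib distrib_right mult.assoc
        simp flip: times_divide_eq_right)
next
  case (step x)
  then obtain ms where composition: "0 \<notin> set ms" "k \<le> length ms" "sum_list ms = n"
    and x_eq: "x = inverse_fact_prod ms"
    by (auto simp: compositions_def)
  obtain c where multiple_of_k: "multinomial ms * bch_d n = k * c"
    using dvd_multinomial_mult_bch_d[OF composition(1) \<open>k > 0\<close> composition(2)] composition(3)
    by blast
  have "x / of_nat k * of_nat (fact n * bch_d n) =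
      inverse_fact_prod ms * fact n * of_nat (bch_d n) / of_nat k"
    by (simp add: x_eq)
  also have "\<dots> = of_nat (multinomial ms * bch_d n) / of_nat k"
    using inverse_fact_prod_mult_fact[of ms] composition(3) by simp
  also have "\<dots> = of_nat c" using \<open>k > 0\<close> by (simp add: multiple_of_k)
  finally show ?case by simp
qed

definition inverse_fact_series :: "nat \<Rightarrow> 'a ncps set" where
  "inverse_fact_series k = {X. \<forall>w. ncps_coeff w X \<in> inverse_fact_span k (length w)}"

lemma one_in_inverse_fact_series: "1 \<in> inverse_fact_series 0"
  using inverse_fact_prod_in_inverse_fact_span[of "[]" 0 0]
  by (auto simp: inverse_fact_series_def ncps_coeff_one compositions_def inverse_fact_prod_def)

lemma mult_in_inverse_fact_series:
  assumes "X \<in> inverse_fact_series k" "Y \<in> inverse_fact_series l"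
  shows "X * Y \<in> inverse_fact_series (k + l)"
proof -
  have "ncps_coeff (take i w) X * ncps_coeff (drop i w) Y \<in> inverse_fact_span (k + l) (length w)"
    if "i \<le> length w" for i w
  proof -
    have "ncps_coeff (take i w) X \<in> inverse_fact_span k (length (take i w))"
      and "ncps_coeff (drop i w) Y \<in> inverse_fact_span l (length (drop i w))"
      using assms by (simp_all only: inverse_fact_series_def mem_Collect_eq)
    from mult_in_inverse_fact_span[OF this] show ?thesis using that by simp
  qed
  then show ?thesis
    by (auto simp: inverse_fact_series_def ncps_coeff_mult intro!: sum_in_inverse_fact_span)
qed

lemma power_in_inverse_fact_series:
  "X \<in> inverse_fact_series k \<Longrightarrow> X ^ m \<in> inverse_fact_series (m * k)"
  by (induction m) (auto intro: one_in_inverse_fact_series mult_in_inverse_fact_series)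

lemma diff_one_in_inverse_fact_series:
  assumes "Y \<in> inverse_fact_series 0" "ncps_coeff [] Y = 1"
  shows "Y - 1 \<in> inverse_fact_series 1"
proof -
  have "ncps_coeff w (Y - 1) \<in> inverse_fact_span 1 (length w)" for w
    using assms inverse_fact_span_0_eq[of "length w"]
    by (cases "w = []") (auto simp: inverse_fact_series_def ncps_coeff_one)
  then show ?thesis by (simp add: inverse_fact_series_def)
qed

lemma ncps_coeff_var_mult:
  "ncps_coeff w (ncps_var x * X) = (case w of [] \<Rightarrow> 0 | y # v \<Rightarrow> if y = x then ncps_coeff v X else 0)"
proof (cases w)
  case (Cons y v)
  have "ncps_coeff (take (Suc i) w) (ncps_var x) * ncps_coeff (drop (Suc i) w) X =
      (if i = 0 then (if y = x then ncps_coeff v X else 0) else 0)" if "i \<le> length v" for i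
    using that by (cases i) (auto simp: Cons ncps_coeff_var)
  then show ?thesis
    by (simp add: Cons ncps_coeff_mult sum.atMost_Suc_shift ncps_coeff_var del: sum.atMost_Suc)
qed (simp add: ncps_coeff_mult ncps_coeff_var)

lemma ncps_coeff_var_power:
  "ncps_coeff w (ncps_var x ^ m) = (if w = replicate m x then 1 else 0)"
  by (induction m arbitrary: w) (auto simp: ncps_coeff_one ncps_coeff_var_mult split: list.split)

lemma exp_var_in_inverse_fact_series: "ncps_exp (ncps_var x) \<in> inverse_fact_series 0"
proof -
  have "1 / fact m \<in> inverse_fact_span 0 m" for m
    using inverse_fact_prod_in_inverse_fact_span[of "[]" 0 0]
      inverse_fact_prod_in_inverse_fact_span[of "[m]" 0 m]
    by (cases "m = 0") (simp_all add: compositions_def inverse_fact_prod_def)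
  then have "ncps_coeff w (ncps_var x ^ m) / fact m \<in> inverse_fact_span 0 (length w)" for w m
    by (simp add: ncps_coeff_var_power)
  then show ?thesis
    by (simp add: inverse_fact_series_def ncps_coeff_exp ncps_coeff_var sum_in_inverse_fact_span)
qed

subsection \<open>Denominators\<close>

lemma denom_dvdI:
  assumes "r * of_nat N \<in> \<int>"
  shows "denom r dvd N"
proof (cases "N = 0")
  case False
  let ?P = "\<lambda>d. d > 0 \<and> r * of_nat d \<in> \<int>"
  have "?P (denom r)"
    unfolding denom_def by (rule LeastI[of ?P N]) (use False assms in simp)
  have "(of_nat N :: rat) = of_nat (N div denom r) * of_nat (denom r) + of_nat (N mod denom r)"
    by (simp flip: of_nat_mult of_nat_add)
  then have "r * of_nat (N mod denom r) =
      r * of_nat N - of_nat (N div denom r) * (r * of_nat (denom r))"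
    by (simp add: algebra_simps)
  also have "\<dots> \<in> \<int>" using \<open>?P (denom r)\<close> assms by auto
  finally have "r * of_nat (N mod denom r) \<in> \<int>" .
  moreover have "\<not> ?P (N mod denom r)"
    using not_less_Least[of "N mod denom r" ?P] \<open>?P (denom r)\<close> unfolding denom_def by simp
  ultimately show ?thesis by (simp add: dvd_eq_mod_eq_0)
qed simp

theorem denom_ncps_coeff_log_dvd:
  assumes "Y \<in> inverse_fact_series 0" "ncps_coeff [] Y = 1"
  shows "denom (ncps_coeff w (ncps_log Y)) dvd fact (length w) * bch_d (length w)"
proof (rule denom_dvdI)
  define N :: rat where "N = of_nat (fact (length w) * bch_d (length w))"
  have "(Y - 1) ^ k \<in> inverse_fact_series k" for k
    using power_in_inverse_fact_series[OF diff_one_in_inverse_fact_series[OF assms]] by simp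
  then have "ncps_coeff w ((Y - 1) ^ k) / of_nat k * N \<in> \<int>" if "k > 0" for k
    unfolding N_def using that
    by (intro inverse_fact_span_divide_in_Ints) (auto simp: inverse_fact_series_def)
  then have "(-1) ^ (k + 1) * (ncps_coeff w ((Y - 1) ^ k) / of_nat k * N) \<in> \<int>"
    if "k \<in> {1..length w}" for k
    using that by (intro Ints_mult[of "(-1) ^ (k + 1)"]) auto
  then have "(\<Sum>k = 1..length w. (-1) ^ (k + 1) * (ncps_coeff w ((Y - 1) ^ k) / of_nat k * N))
      \<in> \<int>"
    by (rule Ints_sum)
  then show "ncps_coeff w (ncps_log Y) * of_nat (fact (length w) * bch_d (length w)) \<in> \<int>"
    unfolding ncps_coeff_log[OF assms(2)] sum_distrib_right N_def[symmetric] by (simp add: mult.assoc)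
qed

theorem theorem1:
  fixes n :: nat and w :: "letter list"
  assumes "n \<ge> 1" and "length w = n"
  shows "denom (ncps_coeff w BCH) dvd fact n * bch_d n"
proof -
  have "ncps_exp (ncps_var Letter_A) * ncps_exp (ncps_var Letter_B) \<in> inverse_fact_series 0"
    using mult_in_inverse_fact_series[OF exp_var_in_inverse_fact_series exp_var_in_inverse_fact_series]
    by simp
  then show ?thesis
    unfolding BCH_def assms(2)[symmetric]
    using ncps_coeff_Nil_exp_mult_exp by (rule denom_ncps_coeff_log_dvd)
qed

end
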